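(* Let $\Bbbk$ be an algebraically closed field, let $A$ be the Kronecker algebra over $\Bbbk$, and let $M$ be a finite-dimensional $A$-module with dimension vector $(d_1,d_2)$. Let $M=P_M\oplus R_M\oplus I_M$ be a decomposition of $M$ into its preprojective, regular and preinjective parts. If $\{g_1,\dots,g_b\}$ is a basis of $\operatorname{Hom}_A(I_{d_1},R_M\oplus I_M)$, then $$\sum_{i=1}^b\operatorname{Im}g_i=I_M.$$
   Context: The Kronecker algebra $A$ is the path algebra over $\Bbbk$ of the quiver with two vertices $1,2$ and two arrows $\alpha,\beta\colon1\to2$. Finite-dimensional $A$-modules are identified with representations $M=(M(\alpha),M(\beta))$ of this quiver, where with $\underline{\dim}M=(\dim M(1),\dim M(2))=(d_1,d_2)$ the $M(\alpha),M(\beta)$ are $d_2\times d_1$ matrices (empty matrices allowed). A complete list $\mathcal{L}=\mathcal{P}\cup\mathcal{R}\cup\mathcal{I}$ of representatives of isoclasses of indecomposable $A$-modules is: preprojectives $\mathcal{P}=\{P_n\mid n\ge1\}$ with $P_n=\left(\begin{bmatrix}E_{n-1}\\ 0\end{bmatrix},\begin{bmatrix}0\\ E_{n-1}\end{bmatrix}\right)$ (size $n\times(n-1)$); preinjectives $\mathcal{I}=\{I_n\mid n\ge1\}$ with $I_n=([E_{n-1}\ 0],[0\ E_{n-1}])$ (size $(n-1)\times n$); regulars $\mathcal{R}=\{R_n(\lambda)=(E_n,J_n(\lambda)),\ R_n(\infty)=(J_n(0),E_n)\mid n\ge1,\lambda\in\Bbbk\}$, with $E_n$ the identity matrix and $J_n(\lambda)$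 the (upper triangular) Jordan cell of size $n$ with eigenvalue $\lambda$. Convention: $I_0=0$. The map $\boldsymbol{d}_M\colon\mathcal{L}\to\mathbb{N}_0$ is the unique one with $M\cong\bigoplus_{L\in\mathcal{L}}L^{(\boldsymbol{d}_M(L))}$. Fix an isomorphism $F\colon\bigoplus_{L\in\mathcal{L}}L^{(\boldsymbol{d}_M(L))}\to M$; the submodules $P_M,R_M,I_M$ of $M$ are the images under $F$ of $\bigoplus_{L\in\mathcal{P}}L^{(\boldsymbol{d}_M(L))}$, $\bigoplus_{L\in\mathcal{R}}L^{(\boldsymbol{d}_M(L))}$, $\bigoplus_{L\in\mathcal{I}}L^{(\boldsymbol{d}_M(L))}$ respectively. An empty sum of submodules is $0$. *)

theory Defs
  imports
    "Jordan_Normal_Form.Jordan_Normal_Form"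
    "Jordan_Normal_Form.VS_Connect"
    "HOL-Computational_Algebra.Polynomial"
begin

section \<open>Representations of the Kronecker quiver\<close>

text \<open>A representation is the pair \<open>(M(\<alpha>), M(\<beta>))\<close> of matrices of equal size \<open>d2 \<times> d1\<close>.
  Sizes are part of the matrix type, so matrices without rows or columns keep their dimension vector.
  A homomorphism is a pair \<open>(f1, f2)\<close> of matrices, one per vertex, and a submodule
  of a representation is a pair \<open>(U1, U2)\<close> of sets of column vectors.\<close>

type_synonym 'k kron_rep = "'k mat \<times> 'k mat"
type_synonym 'k kron_map = "'k mat \<times> 'k mat"
type_synonym 'k kron_sub = "'k vec set \<times> 'k vec set"

definition kron_reps :: "nat \<Rightarrow> nat \<Rightarrow> 'k kron_rep set" where
  "kron_reps d1 d2 = carrier_mat d2 d1 \<times> carrier_mat d2 d1"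

definition dim1 :: "'k kron_rep \<Rightarrow> nat" where
  "dim1 M = dim_col (fst M)"

definition dim2 :: "'k kron_rep \<Rightarrow> nat" where
  "dim2 M = dim_row (fst M)"

definition kron_hom :: "'k::field kron_rep \<Rightarrow> 'k kron_rep \<Rightarrow> 'k kron_map set" where
  "kron_hom L M = {(f1, f2).
     f1 \<in> carrier_mat (dim1 M) (dim1 L) \<and> f2 \<in> carrier_mat (dim2 M) (dim2 L) \<and>
     f2 * fst L = fst M * f1 \<and> f2 * snd L = snd M * f1}"

definition kron_comp :: "'k::field kron_map \<Rightarrow> 'k kron_map \<Rightarrow> 'k kron_map" where
  "kron_comp g f = (fst g * fst f, snd g * snd f)"

definition kron_id :: "'k::field kron_rep \<Rightarrow> 'k kron_map" where
  "kron_id M = (1\<^sub>m (dim1 M), 1\<^sub>m (dim2 M))"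

definition kron_iso :: "'k::field kron_rep \<Rightarrow> 'k kron_rep \<Rightarrow> 'k kron_map set" where
  "kron_iso L M = {F \<in> kron_hom L M.
     \<exists>G \<in> kron_hom M L. kron_comp G F = kron_id L \<and> kron_comp F G = kron_id M}"

definition kron_image :: "'k::field kron_map \<Rightarrow> 'k kron_sub" where
  "kron_image f =
     ((\<lambda>x. fst f *\<^sub>v x) ` carrier_vec (dim_col (fst f)),
      (\<lambda>x. snd f *\<^sub>v x) ` carrier_vec (dim_col (snd f)))"

section \<open>Submodules\<close>

definition kron_submodule :: "'k::field kron_rep \<Rightarrow> 'k kron_sub \<Rightarrow> bool" where
  "kron_submodule M U \<longleftrightarrow>
     subspace class_ring (fst U) (module_vec TYPE('k) (dim1 M)) \<and>
     subspace class_ring (snd U) (module_vec TYPE('k) (dim2 M)) \<and>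
     (\<forall>x \<in> fst U. fst M *\<^sub>v x \<in> snd U \<and> snd M *\<^sub>v x \<in> snd U)"

definition sub_plus :: "'k::field kron_sub \<Rightarrow> 'k kron_sub \<Rightarrow> 'k kron_sub" where
  "sub_plus U W =
     ({u + w | u w. u \<in> fst U \<and> w \<in> fst W}, {u + w | u w. u \<in> snd U \<and> w \<in> snd W})"

text \<open>The sum of a finite family of submodules of \<open>M\<close>; it is the zero submodule for \<open>I = {}\<close>.\<close>

definition sub_sum :: "'k::field kron_rep \<Rightarrow> ('i \<Rightarrow> 'k kron_sub) \<Rightarrow> 'i set \<Rightarrow> 'k kron_sub" where
  "sub_sum M U I =
     ({finsum_vec TYPE('k) (dim1 M) u I | u. \<forall>i \<in> I. u i \<in> fst (U i)},
      {finsum_vec TYPE('k) (dim2 M) u I | u. \<forall>i \<in> I. u i \<in> snd (U i)})"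

text \<open>\<open>Hom(L, N)\<close> for a submodule \<open>N\<close> of \<open>M\<close>, as a vector space: homomorphisms
  into \<open>N\<close> are the homomorphisms into \<open>M\<close> whose image lies in \<open>N\<close>.\<close>

definition kron_hom_into :: "'k::field kron_rep \<Rightarrow> 'k kron_rep \<Rightarrow> 'k kron_sub \<Rightarrow> 'k kron_map set" where
  "kron_hom_into L M N =
     {f \<in> kron_hom L M. fst (kron_image f) \<subseteq> fst N \<and> snd (kron_image f) \<subseteq> snd N}"

definition kron_hom_space ::
  "'k::field kron_rep \<Rightarrow> 'k kron_rep \<Rightarrow> 'k kron_sub \<Rightarrow> ('k, 'k kron_map) module" where
  "kron_hom_space L M N =
     (direct_sum (module_mat TYPE('k) (dim1 M) (dim1 L)) (module_mat TYPE('k) (dim2 M) (dim2 L)))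
       \<lparr>carrier := kron_hom_into L M N\<rparr>"

text \<open>The spaces of homomorphisms into a submodule are vector spaces, so that
  \<^const>\<open>vectorspace.basis\<close> has its intended meaning for them.\<close>

lemma kron_submodule_image:
  fixes f :: "'k::field kron_map"
  assumes L: "L \<in> kron_reps e1 e2" and M: "M \<in> kron_reps d1 d2" and f: "f \<in> kron_hom L M"
  shows "kron_submodule M (kron_image f)"
proof -
  have dims: "dim1 L = e1" "dim2 L = e2" "dim1 M = d1" "dim2 M = d2"
    using L M by (auto simp: kron_reps_def dim1_def dim2_def)
  have carr: "fst L \<in> carrier_mat e2 e1" "snd L \<in> carrier_mat e2 e1"
    "fst M \<in> carrier_mat d2 d1" "snd M \<in> carrier_mat d2 d1"
    using L M by (auto simp: kron_reps_def)
  have f1: "fst f \<in> carrier_mat d1 e1" and f2: "snd f \<in> carrier_mat d2 e2"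
    and eqs: "snd f * fst L = fst M * fst f" "snd f * snd L = snd M * fst f"
    using f dims by (auto simp: kron_hom_def)
  have sub: "subspace class_ring ((\<lambda>x. A *\<^sub>v x) ` carrier_vec c) (module_vec TYPE('k) r)"
    if A: "A \<in> carrier_mat r c" for A :: "'k mat" and r c
  proof -
    interpret V: vec_space "TYPE('k)" r .
    show ?thesis
    proof (unfold_locales, goal_cases)
      case 1 show ?case using A by auto
    next
      case (2 v w)
      then obtain x y where "x \<in> carrier_vec c" "v = A *\<^sub>v x" "y \<in> carrier_vec c" "w = A *\<^sub>v y"
        by auto
      then show ?case using A
        by (auto intro!: image_eqI[of _ _ "x + y"] simp: mult_add_distrib_mat_vec module_vec_simps)
    next
      case 3 show ?case using A
        by (auto intro!: image_eqI[of _ _ "0\<^sub>v c"] simp: module_vec_simps)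
    next
      case (4 a v)
      then obtain x where "x \<in> carrier_vec c" "v = A *\<^sub>v x" by auto
      then show ?case using A
        by (auto intro!: image_eqI[of _ _ "a \<cdot>\<^sub>v x"] simp: mult_mat_vec module_vec_simps)
    qed
  qed
  have stable: "B *\<^sub>v (fst f *\<^sub>v x) \<in> (\<lambda>x. snd f *\<^sub>v x) ` carrier_vec e2"
    if B: "B \<in> carrier_mat d2 d1" and C: "C \<in> carrier_mat e2 e1" and e: "snd f * C = B * fst f"
      and x: "x \<in> carrier_vec e1" for B C x
  proof -
    have "B *\<^sub>v (fst f *\<^sub>v x) = snd f *\<^sub>v (C *\<^sub>v x)"
      using assoc_mult_mat_vec[OF B f1 x] assoc_mult_mat_vec[OF f2 C x] e by simp
    then show ?thesis using C x by auto
  qed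
  show ?thesis
    unfolding kron_submodule_def kron_image_def dims
    using sub[OF f1] sub[OF f2] stable[OF carr(3,1) eqs(1)] stable[OF carr(4,2) eqs(2)] f1 f2
    by auto
qed

lemma kron_submodule_sub_plus:
  fixes U W :: "'k::field kron_sub"
  assumes M: "M \<in> kron_reps d1 d2" and U: "kron_submodule M U" and W: "kron_submodule M W"
  shows "kron_submodule M (sub_plus U W)"
proof -
  have dims: "dim1 M = d1" "dim2 M = d2"
    and carr: "fst M \<in> carrier_mat d2 d1" "snd M \<in> carrier_mat d2 d1"
    using M by (auto simp: kron_reps_def dim1_def dim2_def)
  have sub: "subspace class_ring {u + w | u w. u \<in> A \<and> w \<in> B} (module_vec TYPE('k) n)"
    if A: "subspace class_ring A (module_vec TYPE('k) n)"
      and B: "subspace class_ring B (module_vec TYPE('k) n)" for A B n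
  proof -
    interpret V: vec_space "TYPE('k)" n .
    have "submodule class_ring (V.submodule_sum A B) (module_vec TYPE('k) n)"
      using A B by (intro V.sum_is_submodule subspace.submod)
    moreover have "V.submodule_sum A B = {u + w | u w. u \<in> A \<and> w \<in> B}"
      by (auto simp: V.submodule_sum_def module_vec_simps)
    ultimately show ?thesis
      using V.vectorspace_axioms by (simp add: VectorSpace.subspace_def)
  qed
  have inc: "fst U \<subseteq> carrier_vec d1" "fst W \<subseteq> carrier_vec d1"
    using U W submodule.subset
    by (fastforce simp: kron_submodule_def VectorSpace.subspace_def dims module_vec_simps)+
  show ?thesis
    using U W sub[of "fst U" d1 "fst W"] sub[of "snd U" d2 "snd W"] inc
      mult_add_distrib_mat_vec[OF carr(1)] mult_add_distrib_mat_vec[OF carr(2)]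
    unfolding kron_submodule_def sub_plus_def dims
    by (fastforce simp: subset_iff)
qed

lemma vectorspace_kron_hom_space:
  fixes L M :: "'k::field kron_rep"
  assumes L: "L \<in> kron_reps e1 e2" and M: "M \<in> kron_reps d1 d2" and N: "kron_submodule M N"
  shows "vectorspace class_ring (kron_hom_space L M N)"
proof -
  let ?V = "direct_sum (module_mat TYPE('k) d1 e1) (module_mat TYPE('k) d2 e2)"
  have dims: "dim1 L = e1" "dim2 L = e2" "dim1 M = d1" "dim2 M = d2"
    using L M by (auto simp: kron_reps_def dim1_def dim2_def)
  have carr: "fst L \<in> carrier_mat e2 e1" "snd L \<in> carrier_mat e2 e1"
    "fst M \<in> carrier_mat d2 d1" "snd M \<in> carrier_mat d2 d1"
    using L M by (auto simp: kron_reps_def)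
  have V: "vectorspace class_ring ?V"
    by (intro direct_sum_is_vs matrix_vs)
  have N1: "submodule class_ring (fst N) (module_vec TYPE('k) d1)"
    and N2: "submodule class_ring (snd N) (module_vec TYPE('k) d2)"
    using N by (auto simp: kron_submodule_def VectorSpace.subspace_def dims)
  note cl1 = submodule.m_closed[OF N1] submodule.zero_closed[OF N1] submodule.smult_closed[OF N1]
  note cl2 = submodule.m_closed[OF N2] submodule.zero_closed[OF N2] submodule.smult_closed[OF N2]
  note cl = cl1[unfolded module_vec_simps, simplified] cl2[unfolded module_vec_simps, simplified]
  have mem: "(f1, f2) \<in> kron_hom_into L M N \<longleftrightarrow>
      f1 \<in> carrier_mat d1 e1 \<and> f2 \<in> carrier_mat d2 e2 \<and>
      f2 * fst L = fst M * f1 \<and> f2 * snd L = snd M * f1 \<and>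
      (\<forall>x \<in> carrier_vec e1. f1 *\<^sub>v x \<in> fst N) \<and> (\<forall>x \<in> carrier_vec e2. f2 *\<^sub>v x \<in> snd N)"
    for f1 f2
    by (auto simp: kron_hom_into_def kron_hom_def kron_image_def dims)
  have "submodule class_ring (kron_hom_into L M N) ?V"
  proof (rule submodule.intro, goal_cases)
    case 1 show ?case using V by (simp add: vectorspace_def)
  next
    case 2 show ?case
      by (auto simp: direct_sum_def module_mat_simps mem)
  next
    case (3 v w)
    then show ?case using carr
      by (cases v; cases w)
        (auto simp: direct_sum_def module_mat_simps mem add_mult_distrib_mat mult_add_distrib_mat
          add_mult_distrib_mat_vec cl)
  next
    case 4
    have "0\<^sub>m r s *\<^sub>v x = (0\<^sub>v r :: 'k vec)" if "x \<in> carrier_vec s" for x r s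
      using that by (intro eq_vecI) auto
    then show ?case using carr
      by (auto simp: direct_sum_def module_mat_simps mem cl)
  next
    case (5 c v)
    have smv: "(c \<cdot>\<^sub>m A) *\<^sub>v x = c \<cdot>\<^sub>v (A *\<^sub>v x)"
      if "A \<in> carrier_mat r s" "x \<in> carrier_vec s" for A :: "'k mat" and x r s
      using that by auto
    from 5 show ?case using carr
      by (cases v)
        (auto simp: direct_sum_def module_mat_simps mem mult_smult_distrib mult_smult_assoc_mat
          smv cl)
  qed
  then have "vectorspace class_ring (?V\<lparr>carrier := kron_hom_into L M N\<rparr>)"
    using V by (intro vectorspace.subspace_is_vs[OF V]) (simp add: VectorSpace.subspace_def)
  then show ?thesis by (simp add: kron_hom_space_def dims)
qed

section \<open>The indecomposables\<close>

text \<open>For \<open>n = 0\<close> natural-number subtraction makes \<open>kron_I 0\<close> the zero representation.\<close>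

definition kron_P :: "nat \<Rightarrow> 'k::field kron_rep" where
  "kron_P n =
     (mat n (n - 1) (\<lambda>(i, j). if i = j then 1 else 0),
      mat n (n - 1) (\<lambda>(i, j). if i = Suc j then 1 else 0))"

definition kron_I :: "nat \<Rightarrow> 'k::field kron_rep" where
  "kron_I n =
     (mat (n - 1) n (\<lambda>(i, j). if i = j then 1 else 0),
      mat (n - 1) n (\<lambda>(i, j). if Suc i = j then 1 else 0))"

definition kron_R :: "nat \<Rightarrow> 'k::field \<Rightarrow> 'k kron_rep" where
  "kron_R n a = (1\<^sub>m n, jordan_block n a)"

definition kron_R_inf :: "nat \<Rightarrow> 'k::field kron_rep" where
  "kron_R_inf n = (jordan_block n 0, 1\<^sub>m n)"

definition preprojectives :: "'k::field kron_rep set" where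
  "preprojectives = {kron_P n | n. n \<ge> 1}"

definition regulars :: "'k::field kron_rep set" where
  "regulars = {kron_R n a | n a. n \<ge> 1} \<union> {kron_R_inf n | n. n \<ge> 1}"

definition preinjectives :: "'k::field kron_rep set" where
  "preinjectives = {kron_I n | n. n \<ge> 1}"

definition indecomposables :: "'k::field kron_rep set" where
  "indecomposables = preprojectives \<union> regulars \<union> preinjectives"

section \<open>Decompositions into indecomposables\<close>

definition kron_dsum :: "'k::field kron_rep list \<Rightarrow> 'k kron_rep" where
  "kron_dsum Ls = (diag_block_mat (map fst Ls), diag_block_mat (map snd Ls))"

text \<open>An isomorphism \<open>F\<close> from a finite direct sum of indecomposables to \<open>M\<close>. Summands are listed with
  repetition and in any order: the multiplicity \<open>d\<^sub>M(L)\<close> is \<open>count_list Ls L\<close>.\<close>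

definition kron_decomposition :: "'k::field kron_rep \<Rightarrow> 'k kron_rep list \<Rightarrow> 'k kron_map \<Rightarrow> bool" where
  "kron_decomposition M Ls F \<longleftrightarrow> set Ls \<subseteq> indecomposables \<and> F \<in> kron_iso (kron_dsum Ls) M"

text \<open>The projection of the direct sum onto the sum of those summands that belong to \<open>X\<close>, as an
  endomorphism of the direct sum. Its image is the subsum of these summands.\<close>

definition subsum_proj :: "'k::field kron_rep set \<Rightarrow> 'k kron_rep list \<Rightarrow> 'k kron_map" where
  "subsum_proj X Ls =
     (diag_block_mat (map (\<lambda>L. if L \<in> X then 1\<^sub>m (dim1 L) else 0\<^sub>m (dim1 L) (dim1 L)) Ls),
      diag_block_mat (map (\<lambda>L. if L \<in> X then 1\<^sub>m (dim2 L) else 0\<^sub>m (dim2 L) (dim2 L)) Ls))"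

text \<open>The image under \<open>F\<close> of the subsum of the summands in \<open>X\<close>.\<close>

definition kron_part :: "'k::field kron_rep set \<Rightarrow> 'k kron_rep list \<Rightarrow> 'k kron_map \<Rightarrow> 'k kron_sub" where
  "kron_part X Ls F = kron_image (kron_comp F (subsum_proj X Ls))"

abbreviation preprojective_part :: "'k::field kron_rep list \<Rightarrow> 'k kron_map \<Rightarrow> 'k kron_sub" where
  "preprojective_part \<equiv> kron_part preprojectives"

abbreviation regular_part :: "'k::field kron_rep list \<Rightarrow> 'k kron_map \<Rightarrow> 'k kron_sub" where
  "regular_part \<equiv> kron_part regulars"

abbreviation preinjective_part :: "'k::field kron_rep list \<Rightarrow> 'k kron_map \<Rightarrow> 'k kron_sub" where
  "preinjective_part \<equiv> kron_part preinjectives"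

end

theory Submission
  imports Defs
begin

text \<open>Let \<open>h : I\<^sub>n \<rightarrow> M\<close>. A preprojective or regular summand of \<open>M\<close> has an injective arrow, and
  this forces every homomorphism from \<open>I\<^sub>n\<close> to that summand to vanish; hence the image of \<open>h\<close> lies in
  \<open>I\<^sub>M\<close>. Conversely, every preinjective summand \<open>I\<^sub>m\<close> of \<open>M\<close> satisfies \<open>m \<le> d\<^sub>1\<close>, because \<open>m\<close> is the first
  entry of its dimension vector, and truncation is a surjection from \<open>I\<close> of index \<open>d\<^sub>1\<close> onto \<open>I\<^sub>m\<close>. The sum of the
  images of a basis of \<open>Hom\<close> contains the image of every homomorphism, hence all of \<open>I\<^sub>M\<close>.\<close>

section \<open>Vectors, matrices and submodules\<close>

lemma zero_mat_mult_vec: "x \<in> carrier_vec c \<Longrightarrow> 0\<^sub>m r c *\<^sub>v x = (0\<^sub>v r :: 'k::semiring_0 vec)"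
  by (intro eq_vecI) auto

lemma mult_mat_zero_vec: "A \<in> carrier_mat r c \<Longrightarrow> A *\<^sub>v 0\<^sub>v c = (0\<^sub>v r :: 'k::semiring_0 vec)"
  by (intro eq_vecI) auto

text \<open>The off-diagonal blocks vanish, so head and tail act independently on the two pieces of
  the vector. Every induction over a list of summands peels off one block in this form.\<close>

lemma diag_block_mat_Cons_mult_vec:
  assumes "A \<in> carrier_mat r c" and "diag_block_mat As \<in> carrier_mat r' c'"
    and "a \<in> carrier_vec c" and "b \<in> carrier_vec c'"
  shows "diag_block_mat (A # As) *\<^sub>v (a @\<^sub>v b) =
    (A *\<^sub>v a :: 'k::comm_semiring_1 vec) @\<^sub>v (diag_block_mat As *\<^sub>v b)"
proof -
  have "diag_block_mat (A # As) = four_block_mat A (0\<^sub>m r c') (0\<^sub>m r' c) (diag_block_mat As)"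
    using assms by (simp add: Let_def)
  then show ?thesis
    using assms by (simp add: zero_mat_mult_vec four_block_mat_mult_vec[of _ r c _ c' _ r'])
qed

lemma append_vec_cases:
  assumes "x \<in> carrier_vec (m + k)"
  obtains a b where "a \<in> carrier_vec m" and "b \<in> carrier_vec k" and "x = a @\<^sub>v b"
  using assms vec_first_last_append[of x m k]
  by (metis vec_first_carrier vec_last_carrier)

lemma append_rows_cases:
  assumes "A \<in> carrier_mat (m + k) n"
  obtains B C where "B \<in> carrier_mat m n" and "C \<in> carrier_mat k n" and "A = B @\<^sub>r C"
proof
  let ?B = "mat m n (\<lambda>(i, j). A $$ (i, j))" and ?C = "mat k n (\<lambda>(i, j). A $$ (i + m, j))"
  show "?B \<in> carrier_mat m n" "?C \<in> carrier_mat k n" by auto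
  show "A = ?B @\<^sub>r ?C"
    using assms by (intro eq_matI) (auto simp: append_rows_def)
qed

lemma eq_mat_on_vecs:
  fixes A B :: "'k::semiring_1 mat"
  assumes "A \<in> carrier_mat r c" and "B \<in> carrier_mat r c"
    and eq: "\<And>x. x \<in> carrier_vec c \<Longrightarrow> A *\<^sub>v x = B *\<^sub>v x"
  shows "A = B"
proof (rule eq_matI)
  fix i j assume "i < dim_row B" "j < dim_col B"
  then have ij: "i < r" "j < c" using assms by auto
  have "(A *\<^sub>v unit_vec c j) $ i = (B *\<^sub>v unit_vec c j) $ i"
    using eq[of "unit_vec c j"] by simp
  then show "A $$ (i, j) = B $$ (i, j)"
    using assms(1,2) ij by simp
qed (use assms in auto)

text \<open>If \<open>m\<close> exceeded \<open>n\<close>, zero padding would turn \<open>A\<close>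
  and \<open>B\<close> into square matrices whose product is still the identity. For square matrices
  the reversed product is then the identity too, but it has a zero row.\<close>

lemma inverse_mats_dim_le:
  fixes A B :: "'k::field mat"
  assumes A: "A \<in> carrier_mat m n" and B: "B \<in> carrier_mat n m" and AB: "A * B = 1\<^sub>m m"
  shows "m \<le> n"
proof (rule ccontr)
  assume "\<not> m \<le> n"
  then have less: "n < m" by simp
  define k where "k = m - n"
  have m: "m = n + k" using less by (simp add: k_def)
  \<comment> \<open>Blocks without rows or without columns make \<open>four_block_mat\<close> append
    \<open>k\<close> zero columns to \<open>A\<close> and \<open>k\<close> zero rows to
    \<open>B\<close>.\<close>
  let ?A = "four_block_mat A (0\<^sub>m m k) (0\<^sub>m 0 n) (0\<^sub>m 0 k)"
  let ?B = "four_block_mat B (0\<^sub>m n 0) (0\<^sub>m k m) (0\<^sub>m k 0)"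
  have cA: "?A \<in> carrier_mat m m" and cB: "?B \<in> carrier_mat m m"
    using A B four_block_carrier_mat[OF A, of "0\<^sub>m 0 k" 0 k]
      four_block_carrier_mat[OF B, of "0\<^sub>m k 0" k 0] m by auto
  have "?A * ?B = four_block_mat (1\<^sub>m m) (0\<^sub>m m 0) (0\<^sub>m 0 m) (0\<^sub>m 0 0)"
    using A B AB
    by (subst mult_four_block_mat[of _ m n _ k _ 0 _ _ m _ 0]) auto
  also have "\<dots> = 1\<^sub>m m" by (intro eq_matI) auto
  finally have "?B * ?A = 1\<^sub>m m" by (rule mat_mult_left_right_inverse[OF cA cB])
  \<comment> \<open>Row \<open>n\<close> is the first of the appended zero rows; it exists because
    \<open>n < m\<close>.\<close>
  moreover have "row ?B n = 0\<^sub>v m" using B less m by (intro eq_vecI) auto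
  then have "(?B * ?A) $$ (n, n) = 0" using cA cB less by (simp del: index_mat_four_block)
  ultimately show False using less by simp
qed

section \<open>Order, binary sums and finite sums of submodules\<close>

lemma vec_subspaceD:
  assumes "subspace class_ring U (module_vec TYPE('k::field) n)"
  shows "U \<subseteq> carrier_vec n" and "0\<^sub>v n \<in> U" and "x \<in> U \<Longrightarrow> y \<in> U \<Longrightarrow> x + y \<in> U"
proof -
  have U: "submodule class_ring U (module_vec TYPE('k) n)"
    using assms by (simp add: VectorSpace.subspace_def)
  show "U \<subseteq> carrier_vec n" "0\<^sub>v n \<in> U" "x \<in> U \<Longrightarrow> y \<in> U \<Longrightarrow> x + y \<in> U"
    using submodule.subset[OF U] submodule.zero_closed[OF U] submodule.m_closed[OF U]
    by (auto simp: module_vec_simps)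
qed

lemma kron_submoduleD:
  fixes U :: "'k::field kron_sub"
  assumes "kron_submodule M U"
  shows "fst U \<subseteq> carrier_vec (dim1 M)" and "0\<^sub>v (dim1 M) \<in> fst U"
    and "\<And>x y. x \<in> fst U \<Longrightarrow> y \<in> fst U \<Longrightarrow> x + y \<in> fst U"
    and "snd U \<subseteq> carrier_vec (dim2 M)" and "0\<^sub>v (dim2 M) \<in> snd U"
    and "\<And>x y. x \<in> snd U \<Longrightarrow> y \<in> snd U \<Longrightarrow> x + y \<in> snd U"
  using assms vec_subspaceD[of "fst U" "dim1 M"] vec_subspaceD[of "snd U" "dim2 M"]
  unfolding kron_submodule_def by blast+

text \<open>Inclusion at both vertices is given a name so that sums can be handled as joins and
  equality of submodules can be split by antisymmetry.\<close>

definition sub_le :: "'k kron_sub \<Rightarrow> 'k kron_sub \<Rightarrow> bool" where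
  "sub_le U W \<longleftrightarrow> fst U \<subseteq> fst W \<and> snd U \<subseteq> snd W"

lemma sub_le_antisym: "sub_le U W \<Longrightarrow> sub_le W U \<Longrightarrow> U = W"
  by (auto simp: sub_le_def prod_eq_iff)

lemma sub_le_trans: "sub_le U W \<Longrightarrow> sub_le W X \<Longrightarrow> sub_le U X"
  by (auto simp: sub_le_def)

lemma sub_le_plus_right:
  fixes U W :: "'k::field kron_sub"
  assumes U: "kron_submodule M U" and W: "kron_submodule M W"
  shows "sub_le W (sub_plus U W)"
proof -
  have "B \<subseteq> {u + w | u w. u \<in> A \<and> w \<in> B}"
    if "B \<subseteq> carrier_vec n" "0\<^sub>v n \<in> A" for A B :: "'k vec set" and n
  proof
    fix x assume "x \<in> B"
    moreover from this have "x = 0\<^sub>v n + x" using that by auto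
    ultimately show "x \<in> {u + w | u w. u \<in> A \<and> w \<in> B}" using that(2) by blast
  qed
  note this[OF kron_submoduleD(1)[OF W] kron_submoduleD(2)[OF U]]
    this[OF kron_submoduleD(4)[OF W] kron_submoduleD(5)[OF U]]
  then show ?thesis unfolding sub_le_def sub_plus_def fst_conv snd_conv ..
qed

lemma sub_le_plus_left:
  fixes U W :: "'k::field kron_sub"
  assumes U: "kron_submodule M U" and W: "kron_submodule M W"
  shows "sub_le U (sub_plus U W)"
proof -
  have "A \<subseteq> {u + w | u w. u \<in> A \<and> w \<in> B}"
    if "A \<subseteq> carrier_vec n" "0\<^sub>v n \<in> B" for A B :: "'k vec set" and n
  proof
    fix x assume "x \<in> A"
    moreover from this have "x = x + 0\<^sub>v n" using that by auto
    ultimately show "x \<in> {u + w | u w. u \<in> A \<and> w \<in> B}" using that(2) by blast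
  qed
  note this[OF kron_submoduleD(1)[OF U] kron_submoduleD(2)[OF W]]
    this[OF kron_submoduleD(4)[OF U] kron_submoduleD(5)[OF W]]
  then show ?thesis unfolding sub_le_def sub_plus_def fst_conv snd_conv ..
qed

lemma sub_plus_least:
  assumes "kron_submodule M W" and "sub_le U W" and "sub_le U' W"
  shows "sub_le (sub_plus U U') W"
  using assms kron_submoduleD(3,6)[OF assms(1)]
  by (auto simp: sub_le_def sub_plus_def subset_iff)

text \<open>A choice of vectors on \<open>insert i I\<close> is a choice at \<open>i\<close>
  together with a choice on \<open>I\<close>. Conversely, a choice on \<open>I\<close> is extended
  by overriding it at \<open>i\<close>.\<close>

lemma finsum_vec_family_insert:
  fixes A :: "'i \<Rightarrow> 'k::comm_monoid_add vec set"
  assumes I: "finite I" "i \<notin> I" and A: "\<And>j. A j \<subseteq> carrier_vec n"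
  shows "{finsum_vec TYPE('k) n u (insert i I) | u. \<forall>j \<in> insert i I. u j \<in> A j} =
    {x + y | x y. x \<in> A i \<and> y \<in> {finsum_vec TYPE('k) n u I | u. \<forall>j \<in> I. u j \<in> A j}}"
    (is "?L = ?R")
proof (intro equalityI subsetI)
  fix z assume "z \<in> ?L"
  then obtain u where u: "\<forall>j \<in> insert i I. u j \<in> A j"
    and z: "z = finsum_vec TYPE('k) n u (insert i I)" by auto
  have "z = u i + finsum_vec TYPE('k) n u I"
    unfolding z using u A by (intro finsum_vec_insert[OF I]) auto
  then show "z \<in> ?R" using u by auto
next
  fix z assume "z \<in> ?R"
  then obtain x u where x: "x \<in> A i" and u: "\<forall>j \<in> I. u j \<in> A j"
    and z: "z = x + finsum_vec TYPE('k) n u I" by auto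
  have "finsum_vec TYPE('k) n (u(i := x)) (insert i I) =
      (u(i := x)) i + finsum_vec TYPE('k) n (u(i := x)) I"
    using u x A I by (intro finsum_vec_insert[OF I]) auto
  \<comment> \<open>Overriding at \<open>i\<close> leaves the sum over \<open>I\<close> unchanged
    because \<open>i\<close> is not in \<open>I\<close>.\<close>
  also have "finsum_vec TYPE('k) n (u(i := x)) I = finsum_vec TYPE('k) n u I"
    unfolding finsum_vec_def
    by (rule comm_monoid.finprod_cong'[OF comm_monoid_vec])
      (use u I A in \<open>auto simp: monoid_vec_simps\<close>)
  finally have "z = finsum_vec TYPE('k) n (u(i := x)) (insert i I)" using z by (simp only: fun_upd_same)
  moreover have "\<forall>j \<in> insert i I. (u(i := x)) j \<in> A j" using x u by auto
  ultimately show "z \<in> ?L" by blast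
qed

text \<open>Applied at each vertex, the previous decomposition reduces finite sums of submodules to
  binary ones.\<close>

lemma sub_sum_insert:
  fixes U :: "'i \<Rightarrow> 'k::field kron_sub"
  assumes "finite I" and "i \<notin> I" and "\<And>j. kron_submodule M (U j)"
  shows "sub_sum M U (insert i I) = sub_plus (U i) (sub_sum M U I)"
proof -
  have 1: "\<And>j. fst (U j) \<subseteq> carrier_vec (dim1 M)" and 2: "\<And>j. snd (U j) \<subseteq> carrier_vec (dim2 M)"
    using kron_submoduleD(1,4)[OF assms(3)] by auto
  show ?thesis
    unfolding sub_sum_def sub_plus_def fst_conv snd_conv
      finsum_vec_family_insert[OF assms(1,2), of "\<lambda>j. fst (U j)", OF 1]
      finsum_vec_family_insert[OF assms(1,2), of "\<lambda>j. snd (U j)", OF 2] by (rule refl)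
qed

text \<open>The zero submodule is the image of the map from the zero representation, so
  \<open>kron_submodule_image\<close> supplies the closure laws.\<close>

lemma kron_submodule_zero:
  fixes M :: "'k::field kron_rep"
  assumes M: "M \<in> kron_reps d1 d2"
  shows "kron_submodule M ({0\<^sub>v d1}, {0\<^sub>v d2})"
proof -
  let ?f = "(0\<^sub>m d1 0, 0\<^sub>m d2 0) :: 'k kron_map" and ?Z = "(0\<^sub>m 0 0, 0\<^sub>m 0 0) :: 'k kron_rep"
  have Z: "?Z \<in> kron_reps 0 0" by (simp add: kron_reps_def)
  have "?f \<in> kron_hom ?Z M"
    using M by (auto simp: kron_hom_def kron_reps_def dim1_def dim2_def)
  from kron_submodule_image[OF Z M this] have "kron_submodule M (kron_image ?f)" .
  \<comment> \<open>The source contains only the empty vector, and a matrix without columns sends it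
    to zero.\<close>
  moreover have "(\<lambda>x. 0\<^sub>m r 0 *\<^sub>v x) ` carrier_vec 0 = {0\<^sub>v r :: 'k vec}" for r
    by (auto intro!: eq_vecI image_eqI[of _ _ vNil] simp: scalar_prod_def)
  ultimately show ?thesis by (simp add: kron_image_def)
qed

text \<open>Induction on the index set reduces this to binary sums. The three claims are proved
  together because the upper bound step needs the partial sum to be a submodule.\<close>

lemma sub_sum_lub:
  fixes U :: "'i \<Rightarrow> 'k::field kron_sub"
  assumes M: "M \<in> kron_reps d1 d2" and I: "finite I" and U: "\<And>i. kron_submodule M (U i)"
  shows "kron_submodule M (sub_sum M U I) \<and> (\<forall>i \<in> I. sub_le (U i) (sub_sum M U I)) \<and>
    (\<forall>W. kron_submodule M W \<longrightarrow> (\<forall>i \<in> I. sub_le (U i) W) \<longrightarrow> sub_le (sub_sum M U I) W)"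
  using I
proof (induction I)
  case empty
  have dims: "dim1 M = d1" "dim2 M = d2" using M by (auto simp: kron_reps_def dim1_def dim2_def)
  then have eq: "sub_sum M U {} = ({0\<^sub>v d1}, {0\<^sub>v d2})"
    by (simp add: sub_sum_def finsum_vec_empty)
  have "sub_le ({0\<^sub>v d1}, {0\<^sub>v d2}) W" if "kron_submodule M W" for W
    using kron_submoduleD(2,5)[OF that] by (simp add: sub_le_def dims)
  then show ?case using kron_submodule_zero[OF M] by (simp add: eq)
next
  case (insert i I)
  note eq = sub_sum_insert[of I i M U, OF insert.hyps(1,2) U]
  have S: "kron_submodule M (sub_sum M U I)" using insert.IH by simp
  show ?case unfolding eq
  proof (intro conjI ballI allI impI)
    show "kron_submodule M (sub_plus (U i) (sub_sum M U I))"
      by (rule kron_submodule_sub_plus[OF M U S])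
    show "sub_le (U j) (sub_plus (U i) (sub_sum M U I))" if "j \<in> insert i I" for j
      using that insert.IH sub_le_plus_left[OF U S] sub_le_trans[OF _ sub_le_plus_right[OF U S]]
      by blast
    show "sub_le (sub_plus (U i) (sub_sum M U I)) W"
      if "kron_submodule M W" "\<forall>j \<in> insert i I. sub_le (U j) W" for W
      using that insert.IH by (blast intro: sub_plus_least)
  qed
qed

section \<open>Homomorphisms and direct sums\<close>

lemma kron_reps_dims:
  assumes "M \<in> kron_reps d1 d2"
  shows "dim1 M = d1" and "dim2 M = d2"
  using assms by (auto simp: kron_reps_def dim1_def dim2_def)

text \<open>Matrices are determined by their action on vectors, so the two commuting squares may be
  tested on vectors. This form fits vectors that are split along a direct sum.\<close>

lemma kron_hom_iff:
  fixes L M :: "'k::field kron_rep"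
  assumes L: "L \<in> kron_reps e1 e2" and M: "M \<in> kron_reps d1 d2"
  shows "(f1, f2) \<in> kron_hom L M \<longleftrightarrow>
    f1 \<in> carrier_mat d1 e1 \<and> f2 \<in> carrier_mat d2 e2 \<and>
    (\<forall>x \<in> carrier_vec e1. f2 *\<^sub>v (fst L *\<^sub>v x) = fst M *\<^sub>v (f1 *\<^sub>v x) \<and>
      f2 *\<^sub>v (snd L *\<^sub>v x) = snd M *\<^sub>v (f1 *\<^sub>v x))"
proof -
  have eq: "f2 * A = B * f1 \<longleftrightarrow> (\<forall>x \<in> carrier_vec e1. f2 *\<^sub>v (A *\<^sub>v x) = B *\<^sub>v (f1 *\<^sub>v x))"
    if f: "f1 \<in> carrier_mat d1 e1" "f2 \<in> carrier_mat d2 e2"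
      and A: "A \<in> carrier_mat e2 e1" and B: "B \<in> carrier_mat d2 d1" for A B
  proof
    assume "f2 * A = B * f1"
    then show "\<forall>x \<in> carrier_vec e1. f2 *\<^sub>v (A *\<^sub>v x) = B *\<^sub>v (f1 *\<^sub>v x)"
      using f A B by (metis assoc_mult_mat_vec)
  next
    assume "\<forall>x \<in> carrier_vec e1. f2 *\<^sub>v (A *\<^sub>v x) = B *\<^sub>v (f1 *\<^sub>v x)"
    then show "f2 * A = B * f1"
      using f A B by (intro eq_mat_on_vecs[of _ d2 e1]) auto
  qed
  show ?thesis
    using eq[of "fst L" "fst M"] eq[of "snd L" "snd M"] L M
    unfolding kron_hom_def kron_reps_dims[OF L] kron_reps_dims[OF M]
    by (auto simp: kron_reps_def)
qed

lemma kron_hom_carrier: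
  assumes "f \<in> kron_hom L M" and "L \<in> kron_reps e1 e2" and "M \<in> kron_reps d1 d2"
  shows "fst f \<in> carrier_mat d1 e1" and "snd f \<in> carrier_mat d2 e2"
  using assms by (auto simp: kron_hom_def kron_reps_dims)

lemma kron_comp_mult_vec:
  fixes f g :: "'k::field kron_map"
  assumes "f \<in> kron_hom L M" and "g \<in> kron_hom M N"
    and "L \<in> kron_reps e1 e2" and "M \<in> kron_reps d1 d2" and "N \<in> kron_reps c1 c2"
  shows "x \<in> carrier_vec e1 \<Longrightarrow> fst (kron_comp g f) *\<^sub>v x = fst g *\<^sub>v (fst f *\<^sub>v x)"
    and "y \<in> carrier_vec e2 \<Longrightarrow> snd (kron_comp g f) *\<^sub>v y = snd g *\<^sub>v (snd f *\<^sub>v y)"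
  using kron_hom_carrier[OF assms(1,3,4)] kron_hom_carrier[OF assms(2,4,5)]
  by (auto simp: kron_comp_def)

lemma kron_comp_hom:
  fixes f g :: "'k::field kron_map"
  assumes f: "f \<in> kron_hom L M" and g: "g \<in> kron_hom M N"
    and L: "L \<in> kron_reps e1 e2" and M: "M \<in> kron_reps d1 d2" and N: "N \<in> kron_reps c1 c2"
  shows "kron_comp g f \<in> kron_hom L N"
proof -
  note cf = kron_hom_carrier[OF f L M] and cg = kron_hom_carrier[OF g M N]
  have cL: "fst L \<in> carrier_mat e2 e1" "snd L \<in> carrier_mat e2 e1"
    using L by (auto simp: kron_reps_def)
  have "(fst g * fst f, snd g * snd f) \<in> kron_hom L N"
    using f g cf cg cL kron_hom_iff[OF L M, of "fst f" "snd f"] kron_hom_iff[OF M N, of "fst g" "snd g"]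
    unfolding kron_hom_iff[OF L N] by (auto simp: assoc_mult_mat_vec[of _ _ d1] assoc_mult_mat_vec[of _ _ d2])
  then show ?thesis by (simp add: kron_comp_def)
qed

lemma sub_le_image_iff:
  assumes "f \<in> kron_hom L M" and "L \<in> kron_reps e1 e2" and "M \<in> kron_reps d1 d2"
  shows "sub_le (kron_image f) U \<longleftrightarrow>
    (\<forall>x \<in> carrier_vec e1. fst f *\<^sub>v x \<in> fst U) \<and> (\<forall>y \<in> carrier_vec e2. snd f *\<^sub>v y \<in> snd U)"
  using kron_hom_carrier[OF assms] by (auto simp: sub_le_def kron_image_def)

section \<open>Finite direct sums and projections onto subsums\<close>

text \<open>Since \<open>dim1\<close> and \<open>dim2\<close> read only the first matrix, the
  content is that the second matrix of each summand has the same size.\<close>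

definition wf_reps :: "'k kron_rep list \<Rightarrow> bool" where
  "wf_reps Ls \<longleftrightarrow> (\<forall>L \<in> set Ls. L \<in> kron_reps (dim1 L) (dim2 L))"

abbreviation sdim1 :: "'k kron_rep list \<Rightarrow> nat" where
  "sdim1 Ls \<equiv> sum_list (map dim1 Ls)"

abbreviation sdim2 :: "'k kron_rep list \<Rightarrow> nat" where
  "sdim2 Ls \<equiv> sum_list (map dim2 Ls)"

lemma kron_dsum_reps:
  assumes "wf_reps Ls"
  shows "kron_dsum Ls \<in> kron_reps (sdim1 Ls) (sdim2 Ls)"
proof -
  have "map (dim_row \<circ> fst) Ls = map dim2 Ls" "map (dim_row \<circ> snd) Ls = map dim2 Ls"
    "map (dim_col \<circ> fst) Ls = map dim1 Ls" "map (dim_col \<circ> snd) Ls = map dim1 Ls"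
    using assms by (auto simp: wf_reps_def kron_reps_def dim1_def dim2_def)
  note eqs = this
  show ?thesis
    unfolding kron_reps_def kron_dsum_def
    by (intro SigmaI carrier_matI) (simp_all only: dim_diag_block_mat map_map eqs)
qed

lemma kron_dsum_Cons_mult_vec:
  fixes L :: "'k::field kron_rep"
  assumes wf: "wf_reps (L # Ls)" and a: "a \<in> carrier_vec (dim1 L)" and b: "b \<in> carrier_vec (sdim1 Ls)"
  shows "fst (kron_dsum (L # Ls)) *\<^sub>v (a @\<^sub>v b) = (fst L *\<^sub>v a) @\<^sub>v (fst (kron_dsum Ls) *\<^sub>v b)"
    and "snd (kron_dsum (L # Ls)) *\<^sub>v (a @\<^sub>v b) = (snd L *\<^sub>v a) @\<^sub>v (snd (kron_dsum Ls) *\<^sub>v b)"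
proof -
  have L: "L \<in> kron_reps (dim1 L) (dim2 L)" and Ls: "wf_reps Ls" using wf by (auto simp: wf_reps_def)
  show "fst (kron_dsum (L # Ls)) *\<^sub>v (a @\<^sub>v b) = (fst L *\<^sub>v a) @\<^sub>v (fst (kron_dsum Ls) *\<^sub>v b)"
    "snd (kron_dsum (L # Ls)) *\<^sub>v (a @\<^sub>v b) = (snd L *\<^sub>v a) @\<^sub>v (snd (kron_dsum Ls) *\<^sub>v b)"
    using L kron_dsum_reps[OF Ls] a b diag_block_mat_Cons_mult_vec
    unfolding kron_dsum_def kron_reps_def fst_conv snd_conv list.map by (auto simp del: diag_block_mat.simps)
qed

lemma subsum_proj_carrier:
  "fst (subsum_proj X Ls) \<in> carrier_mat (sdim1 Ls) (sdim1 Ls)"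
  "snd (subsum_proj X Ls) \<in> carrier_mat (sdim2 Ls) (sdim2 Ls)"
  by (induction Ls) (auto simp: subsum_proj_def Let_def)

lemma subsum_proj_Cons_mult_vec:
  fixes L :: "'k::field kron_rep"
  shows "\<lbrakk>a \<in> carrier_vec (dim1 L); b \<in> carrier_vec (sdim1 Ls)\<rbrakk> \<Longrightarrow>
      fst (subsum_proj X (L # Ls)) *\<^sub>v (a @\<^sub>v b) =
      (if L \<in> X then a else 0\<^sub>v (dim1 L)) @\<^sub>v (fst (subsum_proj X Ls) *\<^sub>v b)"
    and "\<lbrakk>a' \<in> carrier_vec (dim2 L); b' \<in> carrier_vec (sdim2 Ls)\<rbrakk> \<Longrightarrow>
      snd (subsum_proj X (L # Ls)) *\<^sub>v (a' @\<^sub>v b') =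
      (if L \<in> X then a' else 0\<^sub>v (dim2 L)) @\<^sub>v (snd (subsum_proj X Ls) *\<^sub>v b')"
proof -
  note c = subsum_proj_carrier[of X Ls, unfolded subsum_proj_def fst_conv snd_conv]
  show "fst (subsum_proj X (L # Ls)) *\<^sub>v (a @\<^sub>v b) =
      (if L \<in> X then a else 0\<^sub>v (dim1 L)) @\<^sub>v (fst (subsum_proj X Ls) *\<^sub>v b)"
    if "a \<in> carrier_vec (dim1 L)" "b \<in> carrier_vec (sdim1 Ls)"
    unfolding subsum_proj_def fst_conv list.map using that zero_mat_mult_vec c(1)
    by (subst diag_block_mat_Cons_mult_vec[of _ "dim1 L" "dim1 L" _ "sdim1 Ls" "sdim1 Ls"]) auto
  show "snd (subsum_proj X (L # Ls)) *\<^sub>v (a' @\<^sub>v b') =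
      (if L \<in> X then a' else 0\<^sub>v (dim2 L)) @\<^sub>v (snd (subsum_proj X Ls) *\<^sub>v b')"
    if "a' \<in> carrier_vec (dim2 L)" "b' \<in> carrier_vec (sdim2 Ls)"
    unfolding subsum_proj_def snd_conv list.map using that zero_mat_mult_vec c(2)
    by (subst diag_block_mat_Cons_mult_vec[of _ "dim2 L" "dim2 L" _ "sdim2 Ls" "sdim2 Ls"]) auto
qed

text \<open>On each summand the projection is the identity or zero, and both commute with the
  arrows. The block action reduces the claim to one summand at a time.\<close>

lemma subsum_proj_hom:
  fixes Ls :: "'k::field kron_rep list"
  assumes "wf_reps Ls"
  shows "subsum_proj X Ls \<in> kron_hom (kron_dsum Ls) (kron_dsum Ls)"
proof -
  let ?P = "subsum_proj X"
  have "snd (?P Ls) *\<^sub>v (fst (kron_dsum Ls) *\<^sub>v x) = fst (kron_dsum Ls) *\<^sub>v (fst (?P Ls) *\<^sub>v x) \<and>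
    snd (?P Ls) *\<^sub>v (snd (kron_dsum Ls) *\<^sub>v x) = snd (kron_dsum Ls) *\<^sub>v (fst (?P Ls) *\<^sub>v x)"
    if "x \<in> carrier_vec (sdim1 Ls)" for x
    using assms that
  proof (induction Ls arbitrary: x)
    case Nil
    then show ?case by (auto simp: kron_dsum_def subsum_proj_def)
  next
    case (Cons L Ls)
    have L: "fst L \<in> carrier_mat (dim2 L) (dim1 L)" "snd L \<in> carrier_mat (dim2 L) (dim1 L)"
      and Ls: "wf_reps Ls" using Cons.prems by (auto simp: wf_reps_def kron_reps_def)
    have D: "fst (kron_dsum Ls) \<in> carrier_mat (sdim2 Ls) (sdim1 Ls)"
      "snd (kron_dsum Ls) \<in> carrier_mat (sdim2 Ls) (sdim1 Ls)"
      using kron_dsum_reps[OF Ls] by (auto simp: kron_reps_def)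
    obtain a b where ab: "a \<in> carrier_vec (dim1 L)" "b \<in> carrier_vec (sdim1 Ls)" "x = a @\<^sub>v b"
      using Cons.prems(2) by (auto elim: append_vec_cases)
    show ?case
      using Cons.IH[OF Ls ab(2)] ab L D mult_mat_zero_vec
      by (auto simp: kron_dsum_Cons_mult_vec[OF Cons.prems(1)] subsum_proj_Cons_mult_vec
          mult_mat_vec_carrier[OF subsum_proj_carrier(1)])
  qed
  then show ?thesis
    using kron_hom_iff[OF kron_dsum_reps[OF assms] kron_dsum_reps[OF assms], of "fst (?P Ls)" "snd (?P Ls)"]
      subsum_proj_carrier[of X Ls] by simp
qed

section \<open>Homomorphisms out of preinjectives\<close>

lemma kron_I_reps: "kron_I n \<in> kron_reps n (n - 1)"
  by (simp add: kron_I_def kron_reps_def)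

lemma kron_I_unit_vec:
  assumes "j < n"
  shows "fst (kron_I n) *\<^sub>v unit_vec n j = (if Suc j = n then 0\<^sub>v (n - 1) else unit_vec (n - 1) j :: 'k::field vec)"
    and "snd (kron_I n) *\<^sub>v unit_vec n j = (if j = 0 then 0\<^sub>v (n - 1) else unit_vec (n - 1) (j - 1) :: 'k vec)"
  using assms by (auto simp: kron_I_def intro!: eq_vecI)

text \<open>Along the string of basis vectors of \<open>I\<^sub>n\<close>, which is killed by one arrow at each end,
  injectivity of either arrow of \<open>L\<close> propagates the vanishing from the respective end.\<close>

lemma kron_hom_kron_I_zero:
  fixes L :: "'k::field kron_rep"
  assumes L: "L \<in> kron_reps e1 e2" and h: "h \<in> kron_hom (kron_I n) L"
    and inj: "(\<forall>x \<in> carrier_vec e1. fst L *\<^sub>v x = 0\<^sub>v e2 \<longrightarrow> x = 0\<^sub>v e1) \<or>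
      (\<forall>x \<in> carrier_vec e1. snd L *\<^sub>v x = 0\<^sub>v e2 \<longrightarrow> x = 0\<^sub>v e1)"
  shows "h = (0\<^sub>m e1 n, 0\<^sub>m e2 (n - 1))"
proof -
  have h1: "fst h \<in> carrier_mat e1 n" and h2: "snd h \<in> carrier_mat e2 (n - 1)"
    and hom: "\<And>x. x \<in> carrier_vec n \<Longrightarrow> fst L *\<^sub>v (fst h *\<^sub>v x) = snd h *\<^sub>v (fst (kron_I n) *\<^sub>v x)"
    "\<And>x. x \<in> carrier_vec n \<Longrightarrow> snd L *\<^sub>v (fst h *\<^sub>v x) = snd h *\<^sub>v (snd (kron_I n) *\<^sub>v x)"
    using h kron_hom_iff[OF kron_I_reps L, of "fst h" "snd h"] by auto
  have cL: "fst L \<in> carrier_mat e2 e1" "snd L \<in> carrier_mat e2 e1"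
    using L by (auto simp: kron_reps_def)
  have mc: "fst h *\<^sub>v unit_vec n j \<in> carrier_vec e1" for j using h1 by auto
  \<comment> \<open>Each basis vector at the second vertex is reached by both arrows, from
    neighbouring basis vectors at the first vertex. These are the links along which vanishing
    travels.\<close>
  have y: "snd h *\<^sub>v unit_vec (n - 1) j = fst L *\<^sub>v (fst h *\<^sub>v unit_vec n j)"
    "snd h *\<^sub>v unit_vec (n - 1) j = snd L *\<^sub>v (fst h *\<^sub>v unit_vec n (Suc j))" if "Suc j < n" for j
    using that by (simp_all add: hom kron_I_unit_vec)
  have x: "fst h *\<^sub>v unit_vec n j = 0\<^sub>v e1" if "j < n" for j
    using inj
  proof
    assume inj: "\<forall>x \<in> carrier_vec e1. fst L *\<^sub>v x = 0\<^sub>v e2 \<longrightarrow> x = 0\<^sub>v e1"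
    \<comment> \<open>The first arrow kills the last basis vector, so the induction runs downwards
      from \<open>n - 1\<close>.\<close>
    from that have "j \<le> n - 1" by simp
    then show ?thesis
    proof (induction rule: inc_induct)
      case base
      have "fst L *\<^sub>v (fst h *\<^sub>v unit_vec n (n - 1)) = 0\<^sub>v e2"
        using that h2 by (simp add: hom kron_I_unit_vec mult_mat_zero_vec)
      then show ?case using inj mc by blast
    next
      case (step i)
      then have "fst L *\<^sub>v (fst h *\<^sub>v unit_vec n i) = 0\<^sub>v e2"
        using y[of i] cL by (simp add: mult_mat_zero_vec)
      then show ?case using inj mc by blast
    qed
  next
    assume inj: "\<forall>x \<in> carrier_vec e1. snd L *\<^sub>v x = 0\<^sub>v e2 \<longrightarrow> x = 0\<^sub>v e1"
    \<comment> \<open>The second arrow kills the basis vector of index 0, so here the induction runs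
      upwards.\<close>
    from that show ?thesis
    proof (induction j)
      case 0
      have "snd L *\<^sub>v (fst h *\<^sub>v unit_vec n 0) = 0\<^sub>v e2"
        using 0 h2 by (simp add: hom kron_I_unit_vec mult_mat_zero_vec)
      then show ?case using inj mc by blast
    next
      case (Suc j)
      then have "snd L *\<^sub>v (fst h *\<^sub>v unit_vec n (Suc j)) = 0\<^sub>v e2"
        using y[of j] cL by (simp add: mult_mat_zero_vec)
      then show ?case using inj mc by blast
    qed
  qed
  have entry: "A $$ (i, j) = (A *\<^sub>v unit_vec c j) $ i"
    if "A \<in> carrier_mat r c" "i < r" "j < c" for A :: "'k mat" and i j r c
    using that by simp
  have "fst h = 0\<^sub>m e1 n"
    using h1 x by (intro eq_matI) (auto simp: entry[OF h1] simp del: index_mult_mat_vec)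
  \<comment> \<open>Every basis vector at the second vertex is the image under the first arrow of
    one at the first vertex, where \<open>h\<close> is already known to vanish.\<close>
  moreover have "snd h = 0\<^sub>m e2 (n - 1)"
    using h2 x y(1) mult_mat_zero_vec[OF cL(1)]
    by (intro eq_matI) (auto simp: entry[OF h2] simp del: index_mult_mat_vec)
  ultimately show ?thesis by (simp add: prod_eq_iff)
qed

section \<open>Images of preinjectives in a sum of indecomposables\<close>

lemma indecomposable_reps:
  assumes "L \<in> indecomposables"
  shows "L \<in> kron_reps (dim1 L) (dim2 L)"
  using assms
  by (auto simp: indecomposables_def preprojectives_def regulars_def preinjectives_def
      kron_P_def kron_R_def kron_R_inf_def kron_I_def kron_reps_def dim1_def dim2_def)

lemma indecomposables_wf: "set Ls \<subseteq> indecomposables \<Longrightarrow> wf_reps Ls"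
  unfolding wf_reps_def by (blast intro: indecomposable_reps)

text \<open>The first matrix of a preprojective is an identity above a zero row. A regular has an
  identity matrix as its first arrow, or as its second when the parameter is infinity; this is why
  the claim is a disjunction.\<close>

lemma non_preinjective_arrow_inj:
  fixes L :: "'k::field kron_rep"
  assumes "L \<in> indecomposables" and "L \<notin> preinjectives"
  shows "(\<forall>x \<in> carrier_vec (dim1 L). fst L *\<^sub>v x = 0\<^sub>v (dim2 L) \<longrightarrow> x = 0\<^sub>v (dim1 L)) \<or>
    (\<forall>x \<in> carrier_vec (dim1 L). snd L *\<^sub>v x = 0\<^sub>v (dim2 L) \<longrightarrow> x = 0\<^sub>v (dim1 L))"
proof -
  have P_inj: "x = 0\<^sub>v (n - 1)"
    if x: "x \<in> carrier_vec (n - 1)" and eq: "fst (kron_P n) *\<^sub>v x = (0\<^sub>v n :: 'k vec)" for x n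
  proof (rule eq_vecI)
    fix i assume "i < dim_vec (0\<^sub>v (n - 1) :: 'k vec)"
    then have i: "i < n - 1" by simp
    then have "row (fst (kron_P n)) i = (unit_vec (n - 1) i :: 'k vec)"
      by (auto simp: kron_P_def intro!: eq_vecI)
    then have "(fst (kron_P n) *\<^sub>v x) $ i = x $ i"
      using i x by (simp add: kron_P_def)
    then show "x $ i = (0\<^sub>v (n - 1) :: 'k vec) $ i" using eq i by simp
  qed (use x in auto)
  from assms consider (P) n where "L = kron_P n" | (R) n a where "L = kron_R n a"
    | (R_inf) n where "L = kron_R_inf n"
    by (auto simp: indecomposables_def preprojectives_def regulars_def)
  then show ?thesis
  proof cases
    case P
    then have "dim1 L = n - 1" "dim2 L = n" by (auto simp: kron_P_def dim1_def dim2_def)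
    then show ?thesis using P_inj P by auto
  qed (auto simp: kron_R_def kron_R_inf_def dim1_def dim2_def)
qed

text \<open>That the image lies in the preinjective summands is expressed by the projection fixing
  it. Split off the first summand: the component into it is fixed if the summand is preinjective and
  is zero otherwise; the remaining component is covered by induction.\<close>

lemma hom_kron_I_into_preinjectives:
  fixes Ls :: "'k::field kron_rep list"
  assumes "set Ls \<subseteq> indecomposables" and "h \<in> kron_hom (kron_I n) (kron_dsum Ls)"
  shows "x \<in> carrier_vec n \<Longrightarrow> fst (subsum_proj preinjectives Ls) *\<^sub>v (fst h *\<^sub>v x) = fst h *\<^sub>v x"
    and "y \<in> carrier_vec (n - 1) \<Longrightarrow> snd (subsum_proj preinjectives Ls) *\<^sub>v (snd h *\<^sub>v y) = snd h *\<^sub>v y"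
proof -
  let ?P = "subsum_proj preinjectives"
  have "(\<forall>x \<in> carrier_vec n. fst (?P Ls) *\<^sub>v (fst h *\<^sub>v x) = fst h *\<^sub>v x) \<and>
    (\<forall>y \<in> carrier_vec (n - 1). snd (?P Ls) *\<^sub>v (snd h *\<^sub>v y) = snd h *\<^sub>v y)"
    using assms
  proof (induction Ls arbitrary: h)
    case Nil
    then have "fst h \<in> carrier_mat 0 n" "snd h \<in> carrier_mat 0 (n - 1)"
      by (auto simp: kron_hom_def kron_dsum_def dim1_def dim2_def kron_I_def)
    then show ?case by (auto simp: subsum_proj_def)
  next
    case (Cons L Ls)
    have wf: "wf_reps (L # Ls)" and Ls: "wf_reps Ls" and L: "L \<in> kron_reps (dim1 L) (dim2 L)"
      using indecomposables_wf[OF Cons.prems(1)] by (auto simp: wf_reps_def)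
    note D = kron_dsum_reps[OF Ls] and DL = kron_dsum_reps[OF wf]
    have h: "fst h \<in> carrier_mat (dim1 L + sdim1 Ls) n" "snd h \<in> carrier_mat (dim2 L + sdim2 Ls) (n - 1)"
      and hom: "\<And>x. x \<in> carrier_vec n \<Longrightarrow>
        snd h *\<^sub>v (fst (kron_I n) *\<^sub>v x) = fst (kron_dsum (L # Ls)) *\<^sub>v (fst h *\<^sub>v x) \<and>
        snd h *\<^sub>v (snd (kron_I n) *\<^sub>v x) = snd (kron_dsum (L # Ls)) *\<^sub>v (fst h *\<^sub>v x)"
      using Cons.prems(2) kron_hom_iff[OF kron_I_reps DL, of "fst h" "snd h"] by auto
    obtain B1 C1 where 1: "B1 \<in> carrier_mat (dim1 L) n" "C1 \<in> carrier_mat (sdim1 Ls) n" "fst h = B1 @\<^sub>r C1"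
      using h(1) by (rule append_rows_cases)
    obtain B2 C2 where 2: "B2 \<in> carrier_mat (dim2 L) (n - 1)" "C2 \<in> carrier_mat (sdim2 Ls) (n - 1)"
      "snd h = B2 @\<^sub>r C2"
      using h(2) by (rule append_rows_cases)
    have cI: "fst (kron_I n) \<in> carrier_mat (n - 1) n" "snd (kron_I n) \<in> carrier_mat (n - 1) n"
      by (auto simp: kron_I_def)
    have cL: "fst L \<in> carrier_mat (dim2 L) (dim1 L)" "snd L \<in> carrier_mat (dim2 L) (dim1 L)"
      using L by (auto simp: kron_reps_def)
    have m1: "fst h *\<^sub>v x = (B1 *\<^sub>v x) @\<^sub>v (C1 *\<^sub>v x)" if "x \<in> carrier_vec n" for x
      using that 1 by (simp add: mat_mult_append)
    have m2: "snd h *\<^sub>v y = (B2 *\<^sub>v y) @\<^sub>v (C2 *\<^sub>v y)" if "y \<in> carrier_vec (n - 1)" for y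
      using that 2 by (simp add: mat_mult_append)
    have comps: "B2 *\<^sub>v (fst (kron_I n) *\<^sub>v x) = fst L *\<^sub>v (B1 *\<^sub>v x) \<and>
        C2 *\<^sub>v (fst (kron_I n) *\<^sub>v x) = fst (kron_dsum Ls) *\<^sub>v (C1 *\<^sub>v x) \<and>
        B2 *\<^sub>v (snd (kron_I n) *\<^sub>v x) = snd L *\<^sub>v (B1 *\<^sub>v x) \<and>
        C2 *\<^sub>v (snd (kron_I n) *\<^sub>v x) = snd (kron_dsum Ls) *\<^sub>v (C1 *\<^sub>v x)"
      if x: "x \<in> carrier_vec n" for x
    proof -
      have split: "(B2 *\<^sub>v (A *\<^sub>v x)) @\<^sub>v (C2 *\<^sub>v (A *\<^sub>v x)) = (E *\<^sub>v (B1 *\<^sub>v x)) @\<^sub>v (G *\<^sub>v (C1 *\<^sub>v x)) \<Longrightarrow>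
          A \<in> carrier_mat (n - 1) n \<Longrightarrow> E \<in> carrier_mat (dim2 L) (dim1 L) \<Longrightarrow>
          B2 *\<^sub>v (A *\<^sub>v x) = E *\<^sub>v (B1 *\<^sub>v x) \<and> C2 *\<^sub>v (A *\<^sub>v x) = G *\<^sub>v (C1 *\<^sub>v x)" for A E G
        using x 1 2 by (subst (asm) append_vec_eq[of _ "dim2 L"]) auto
      have Ix: "fst (kron_I n) *\<^sub>v x \<in> carrier_vec (n - 1)" "snd (kron_I n) *\<^sub>v x \<in> carrier_vec (n - 1)"
        using mult_mat_vec_carrier[OF cI(1) x] mult_mat_vec_carrier[OF cI(2) x] by simp_all
      have BC: "B1 *\<^sub>v x \<in> carrier_vec (dim1 L)" "C1 *\<^sub>v x \<in> carrier_vec (sdim1 Ls)"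
        using x 1 by auto
      note eqs = hom[OF x, THEN conjunct1] hom[OF x, THEN conjunct2]
      note eqs' = eqs[unfolded m1[OF x] m2[OF Ix(1)] m2[OF Ix(2)] kron_dsum_Cons_mult_vec[OF wf BC]]
      show ?thesis
        using split[OF eqs'(1) cI(1) cL(1)] split[OF eqs'(2) cI(2) cL(2)] by simp
    qed
    have hB: "(B1, B2) \<in> kron_hom (kron_I n) L"
      unfolding kron_hom_iff[OF kron_I_reps L] using 1 2 comps by auto
    have hC: "(C1, C2) \<in> kron_hom (kron_I n) (kron_dsum Ls)"
      unfolding kron_hom_iff[OF kron_I_reps D] using 1 2 comps by auto
    have zero: "L \<notin> preinjectives \<Longrightarrow> B1 = 0\<^sub>m (dim1 L) n \<and> B2 = 0\<^sub>m (dim2 L) (n - 1)"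
      using kron_hom_kron_I_zero[OF L hB] non_preinjective_arrow_inj[of L] Cons.prems(1) by auto
    have IH: "(\<forall>x \<in> carrier_vec n. fst (?P Ls) *\<^sub>v (C1 *\<^sub>v x) = C1 *\<^sub>v x) \<and>
      (\<forall>y \<in> carrier_vec (n - 1). snd (?P Ls) *\<^sub>v (C2 *\<^sub>v y) = C2 *\<^sub>v y)"
      using Cons.IH[OF _ hC] Cons.prems(1) by simp
    have "fst (?P (L # Ls)) *\<^sub>v (fst h *\<^sub>v x) = fst h *\<^sub>v x" if x: "x \<in> carrier_vec n" for x
      unfolding m1[OF x] using IH zero x mult_mat_vec_carrier[OF 1(1) x] mult_mat_vec_carrier[OF 1(2) x]
      by (auto simp: subsum_proj_Cons_mult_vec zero_mat_mult_vec)
    moreover have "snd (?P (L # Ls)) *\<^sub>v (snd h *\<^sub>v y) = snd h *\<^sub>v y" if y: "y \<in> carrier_vec (n - 1)" for y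
      unfolding m2[OF y] using IH zero y mult_mat_vec_carrier[OF 2(1) y] mult_mat_vec_carrier[OF 2(2) y]
      by (auto simp: subsum_proj_Cons_mult_vec zero_mat_mult_vec)
    ultimately show ?case by blast
  qed
  then show "x \<in> carrier_vec n \<Longrightarrow> fst (?P Ls) *\<^sub>v (fst h *\<^sub>v x) = fst h *\<^sub>v x"
    "y \<in> carrier_vec (n - 1) \<Longrightarrow> snd (?P Ls) *\<^sub>v (snd h *\<^sub>v y) = snd h *\<^sub>v y" by auto
qed

section \<open>Truncation between preinjectives and coverage of the preinjective part\<close>

text \<open>For \<open>m \<le> n\<close> this is the canonical quotient map that keeps an initial
  segment of the string of basis vectors at each vertex.\<close>

definition kron_I_trunc :: "nat \<Rightarrow> nat \<Rightarrow> 'k::field kron_map" where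
  "kron_I_trunc n m =
     (mat m n (\<lambda>(i, j). if i = j then 1 else 0), mat (m - 1) (n - 1) (\<lambda>(i, j). if i = j then 1 else 0))"

lemma trunc_mat_mult_vec:
  fixes x :: "'k::comm_semiring_1 vec"
  assumes "m \<le> n" and "x \<in> carrier_vec n"
  shows "mat m n (\<lambda>(i, j). if i = j then 1 else 0) *\<^sub>v x = vec m (($) x)"
proof (rule eq_vecI)
  let ?T = "mat m n (\<lambda>(i, j). if i = j then 1 else 0) :: 'k mat"
  fix i assume "i < dim_vec (vec m (($) x))"
  then have i: "i < m" by simp
  then have "row ?T i = unit_vec n i" using assms by (intro eq_vecI) auto
  then show "(?T *\<^sub>v x) $ i = vec m (($) x) $ i" using i assms by simp
qed simp

text \<open>Padding with zeros gives a preimage.\<close>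

lemma trunc_mat_surj:
  fixes a :: "'k::comm_semiring_1 vec"
  assumes "m \<le> n" and "a \<in> carrier_vec m"
  shows "a \<in> (*\<^sub>v) (mat m n (\<lambda>(i, j). if i = j then 1 else 0)) ` carrier_vec n"
proof
  let ?x = "vec n (\<lambda>i. if i < m then a $ i else 0)"
  show "a = mat m n (\<lambda>(i, j). if i = j then 1 else 0) *\<^sub>v ?x"
    using assms by (subst trunc_mat_mult_vec) (auto intro!: eq_vecI)
qed simp

text \<open>The first arrow drops the last coordinate and the second drops the first one. A
  coordinate \<open>i < m - 1\<close> of the result is read at \<open>i\<close> or at
  \<open>Suc i\<close>; both are below \<open>m\<close> and hence survive truncation.\<close>

lemma kron_I_trunc_hom:
  assumes "m \<ge> 1" and "m \<le> n"
  shows "kron_I_trunc n m \<in> kron_hom (kron_I n) (kron_I m :: 'k::field kron_rep)"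
proof -
  have fst_I: "fst (kron_I k) *\<^sub>v x = vec (k - 1) (($) x)" if "x \<in> carrier_vec k" for x :: "'k vec" and k
    using that by (simp add: kron_I_def trunc_mat_mult_vec)
  have snd_I: "snd (kron_I k) *\<^sub>v x = vec (k - 1) (\<lambda>i. x $ Suc i)"
    if x: "x \<in> carrier_vec k" for x :: "'k vec" and k
  proof (rule eq_vecI)
    fix i assume "i < dim_vec (vec (k - 1) (\<lambda>i. x $ Suc i))"
    then have i: "i < k - 1" by simp
    then have "row (snd (kron_I k)) i = (unit_vec k (Suc i) :: 'k vec)"
      by (auto simp: kron_I_def intro!: eq_vecI)
    then show "(snd (kron_I k) *\<^sub>v x) $ i = vec (k - 1) (\<lambda>i. x $ Suc i) $ i"
      using i x by (simp add: kron_I_def)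
  qed (simp add: kron_I_def)
  show ?thesis
    using assms unfolding kron_I_trunc_def kron_hom_iff[OF kron_I_reps kron_I_reps]
    by (auto simp: fst_I snd_I trunc_mat_mult_vec intro!: eq_vecI)
qed

text \<open>The ambient \<open>M\<close> and \<open>S\<close> stay fixed in the induction over the summands, while the homomorphism
  into \<open>M\<close> is restricted to the remaining summands.\<close>

lemma preinjectives_covered:
  fixes Ls :: "'k::field kron_rep list"
  assumes M: "M \<in> kron_reps d1 d2" and S: "kron_submodule M S"
    and homs: "\<And>h. h \<in> kron_hom (kron_I n) M \<Longrightarrow> sub_le (kron_image h) S"
    and "set Ls \<subseteq> indecomposables" and "\<And>m. kron_I m \<in> set Ls \<Longrightarrow> m \<le> n"
    and "F \<in> kron_hom (kron_dsum Ls) M"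
  shows "sub_le (kron_part preinjectives Ls F) S"
proof -
  let ?P = "subsum_proj preinjectives"
  note dims = kron_reps_dims[OF M]
  have "(\<forall>x \<in> carrier_vec (sdim1 Ls). fst F *\<^sub>v (fst (?P Ls) *\<^sub>v x) \<in> fst S) \<and>
    (\<forall>y \<in> carrier_vec (sdim2 Ls). snd F *\<^sub>v (snd (?P Ls) *\<^sub>v y) \<in> snd S)"
    using assms(4-6)
  proof (induction Ls arbitrary: F)
    case Nil
    then have "fst F \<in> carrier_mat d1 0" "snd F \<in> carrier_mat d2 0"
      by (auto simp: kron_hom_def kron_dsum_def dim1_def dim2_def dims[unfolded dim1_def dim2_def])
    moreover have "A *\<^sub>v x = 0\<^sub>v r" if "A \<in> carrier_mat r 0" "x \<in> carrier_vec 0" for A :: "'k mat" and r x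
      using that by (intro eq_vecI) (auto simp: scalar_prod_def)
    ultimately have "fst F *\<^sub>v x = 0\<^sub>v d1" "snd F *\<^sub>v x = 0\<^sub>v d2" if "x \<in> carrier_vec 0" for x
      using that by auto
    moreover have "0\<^sub>m 0 0 *\<^sub>v x \<in> carrier_vec 0" for x :: "'k vec" by (intro carrier_vecI) simp
    ultimately show ?case
      using kron_submoduleD(2,5)[OF S] by (simp add: subsum_proj_def dims)
  next
    case (Cons L Ls)
    have wf: "wf_reps (L # Ls)" and Ls: "wf_reps Ls" and L: "L \<in> kron_reps (dim1 L) (dim2 L)"
      using indecomposables_wf[OF Cons.prems(1)] by (auto simp: wf_reps_def)
    note D = kron_dsum_reps[OF Ls] and DL = kron_dsum_reps[OF wf, simplified]
    have cL: "fst L \<in> carrier_mat (dim2 L) (dim1 L)" "snd L \<in> carrier_mat (dim2 L) (dim1 L)"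
      using L by (auto simp: kron_reps_def)
    have cD: "fst (kron_dsum Ls) \<in> carrier_mat (sdim2 Ls) (sdim1 Ls)"
      "snd (kron_dsum Ls) \<in> carrier_mat (sdim2 Ls) (sdim1 Ls)"
      using D by (auto simp: kron_reps_def)
    have cF: "fst F \<in> carrier_mat d1 (dim1 L + sdim1 Ls)" "snd F \<in> carrier_mat d2 (dim2 L + sdim2 Ls)"
      using kron_hom_carrier[OF Cons.prems(3) DL M] by auto
    \<comment> \<open>The inclusions of the first summand and of the remaining sum into the whole
      direct sum; composing with \<open>F\<close> restricts it to either piece.\<close>
    let ?inl = "(1\<^sub>m (dim1 L) @\<^sub>r 0\<^sub>m (sdim1 Ls) (dim1 L), 1\<^sub>m (dim2 L) @\<^sub>r 0\<^sub>m (sdim2 Ls) (dim2 L)) :: 'k kron_map"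
    let ?inr = "(0\<^sub>m (dim1 L) (sdim1 Ls) @\<^sub>r 1\<^sub>m (sdim1 Ls), 0\<^sub>m (dim2 L) (sdim2 Ls) @\<^sub>r 1\<^sub>m (sdim2 Ls)) :: 'k kron_map"
    have inl: "(1\<^sub>m m @\<^sub>r 0\<^sub>m k m) *\<^sub>v a = a @\<^sub>v 0\<^sub>v k" if "a \<in> carrier_vec m" for a :: "'k vec" and m k
      using that by (subst mat_mult_append[of _ m m _ k]) (auto simp: zero_mat_mult_vec)
    have inr: "(0\<^sub>m m k @\<^sub>r 1\<^sub>m k) *\<^sub>v a = 0\<^sub>v m @\<^sub>v a" if "a \<in> carrier_vec k" for a :: "'k vec" and m k
      using that by (subst mat_mult_append[of _ m k _ k]) (auto simp: zero_mat_mult_vec)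
    have hom_inl: "?inl \<in> kron_hom L (kron_dsum (L # Ls))"
      unfolding kron_hom_iff[OF L DL] using cL cD
      by (auto simp: inl mult_mat_zero_vec kron_dsum_Cons_mult_vec[OF wf])
    have hom_inr: "?inr \<in> kron_hom (kron_dsum Ls) (kron_dsum (L # Ls))"
      unfolding kron_hom_iff[OF D DL] using cL cD
      by (auto simp: inr mult_mat_zero_vec kron_dsum_Cons_mult_vec[OF wf])
    let ?Fl = "kron_comp F ?inl" and ?Fr = "kron_comp F ?inr"
    have hom_Fl: "?Fl \<in> kron_hom L M" by (rule kron_comp_hom[OF hom_inl Cons.prems(3) L DL M])
    have hom_Fr: "?Fr \<in> kron_hom (kron_dsum Ls) M"
      by (rule kron_comp_hom[OF hom_inr Cons.prems(3) D DL M])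
    note Fl = kron_comp_mult_vec[OF hom_inl Cons.prems(3) L DL M]
    note Fr = kron_comp_mult_vec[OF hom_inr Cons.prems(3) D DL M]
    have IH: "(\<forall>x \<in> carrier_vec (sdim1 Ls). fst ?Fr *\<^sub>v (fst (?P Ls) *\<^sub>v x) \<in> fst S) \<and>
        (\<forall>y \<in> carrier_vec (sdim2 Ls). snd ?Fr *\<^sub>v (snd (?P Ls) *\<^sub>v y) \<in> snd S)"
      using Cons.prems(1,2) by (intro Cons.IH hom_Fr) auto
    have right: "fst F *\<^sub>v (0\<^sub>v (dim1 L) @\<^sub>v (fst (?P Ls) *\<^sub>v b)) \<in> fst S"
      if "b \<in> carrier_vec (sdim1 Ls)" for b
    proof -
      have c: "fst (?P Ls) *\<^sub>v b \<in> carrier_vec (sdim1 Ls)"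
        by (rule mult_mat_vec_carrier[OF subsum_proj_carrier(1) that])
      have "fst ?Fr *\<^sub>v (fst (?P Ls) *\<^sub>v b) \<in> fst S" using IH that by blast
      then show ?thesis using Fr(1)[OF c] inr[OF c] by simp
    qed
    have right': "snd F *\<^sub>v (0\<^sub>v (dim2 L) @\<^sub>v (snd (?P Ls) *\<^sub>v b)) \<in> snd S"
      if "b \<in> carrier_vec (sdim2 Ls)" for b
    proof -
      have c: "snd (?P Ls) *\<^sub>v b \<in> carrier_vec (sdim2 Ls)"
        by (rule mult_mat_vec_carrier[OF subsum_proj_carrier(2) that])
      have "snd ?Fr *\<^sub>v (snd (?P Ls) *\<^sub>v b) \<in> snd S" using IH that by blast
      then show ?thesis using Fr(2)[OF c] inr[OF c] by simp
    qed
    \<comment> \<open>If the first summand is some \<open>kron_I m\<close>, truncation followed by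
      the restriction of \<open>F\<close> is a homomorphism from \<open>kron_I n\<close>, so its
      image lies in \<open>S\<close>. As truncation is surjective at both vertices, the whole image
      of the summand lies in \<open>S\<close>.\<close>
    have left: "(\<forall>a \<in> carrier_vec (dim1 L). fst ?Fl *\<^sub>v a \<in> fst S) \<and>
        (\<forall>a \<in> carrier_vec (dim2 L). snd ?Fl *\<^sub>v a \<in> snd S)" if "L \<in> preinjectives"
    proof -
      from that obtain m where m: "m \<ge> 1" "L = kron_I m" by (auto simp: preinjectives_def)
      then have mn: "m \<le> n" using Cons.prems(2) by simp
      have Lm: "L \<in> kron_reps m (m - 1)" using kron_I_reps m by simp
      note Ld = kron_reps_dims[OF Lm]
      have T: "kron_I_trunc n m \<in> kron_hom (kron_I n) L" using kron_I_trunc_hom m mn by auto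
      note h = kron_comp_hom[OF T hom_Fl kron_I_reps Lm M]
        and hv = kron_comp_mult_vec[OF T hom_Fl kron_I_reps Lm M]
      note hS = homs[OF h, unfolded sub_le_image_iff[OF h kron_I_reps M]]
      have "fst ?Fl *\<^sub>v a \<in> fst S" if a: "a \<in> carrier_vec m" for a
      proof -
        obtain x where "x \<in> carrier_vec n" "a = fst (kron_I_trunc n m) *\<^sub>v x"
          using trunc_mat_surj[OF mn a] by (auto simp: kron_I_trunc_def)
        then show ?thesis using hS hv(1) by metis
      qed
      moreover have "snd ?Fl *\<^sub>v a \<in> snd S" if a: "a \<in> carrier_vec (m - 1)" for a
      proof -
        obtain x where "x \<in> carrier_vec (n - 1)" "a = snd (kron_I_trunc n m) *\<^sub>v x"
          using trunc_mat_surj[OF diff_le_mono[OF mn] a] by (auto simp: kron_I_trunc_def)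
        then show ?thesis using hS hv(2) by metis
      qed
      ultimately show ?thesis using Ld by simp
    qed
    have zero_app: "0\<^sub>v m @\<^sub>v 0\<^sub>v k = (0\<^sub>v (m + k) :: 'k vec)" for m k
      by (intro eq_vecI) auto
    \<comment> \<open>For a summand that is not preinjective, the projection leaves only the zero
      vector.\<close>
    have left1: "fst F *\<^sub>v ((if L \<in> preinjectives then a else 0\<^sub>v (dim1 L)) @\<^sub>v 0\<^sub>v (sdim1 Ls)) \<in> fst S"
      if "a \<in> carrier_vec (dim1 L)" for a
    proof (cases "L \<in> preinjectives")
      case True
      then have "fst ?Fl *\<^sub>v a \<in> fst S" using left that by blast
      then show ?thesis using True Fl(1)[OF that] inl[OF that] by simp
    next
      case False
      then show ?thesis using mult_mat_zero_vec[OF cF(1)] kron_submoduleD(2)[OF S] by (simp add: zero_app dims)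
    qed
    have left2: "snd F *\<^sub>v ((if L \<in> preinjectives then a else 0\<^sub>v (dim2 L)) @\<^sub>v 0\<^sub>v (sdim2 Ls)) \<in> snd S"
      if "a \<in> carrier_vec (dim2 L)" for a
    proof (cases "L \<in> preinjectives")
      case True
      then have "snd ?Fl *\<^sub>v a \<in> snd S" using left that by blast
      then show ?thesis using True Fl(2)[OF that] inl[OF that] by simp
    next
      case False
      then show ?thesis using mult_mat_zero_vec[OF cF(2)] kron_submoduleD(5)[OF S] by (simp add: zero_app dims)
    qed
    \<comment> \<open>A value of \<open>F\<close> is the sum of the contributions of the first
      summand and of the rest. Both lie in \<open>S\<close>, which is closed under addition.\<close>
    have split: "A *\<^sub>v (a @\<^sub>v b) = A *\<^sub>v (a @\<^sub>v 0\<^sub>v k) + A *\<^sub>v (0\<^sub>v m @\<^sub>v b)"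
      if "A \<in> carrier_mat r (m + k)" "a \<in> carrier_vec m" "b \<in> carrier_vec k"
      for A :: "'k mat" and a b r m k
    proof -
      have "a @\<^sub>v b = (a @\<^sub>v 0\<^sub>v k) + (0\<^sub>v m @\<^sub>v b)"
        using that by (subst append_vec_add[of _ m _ _ k]) auto
      then show ?thesis using that by (simp add: mult_add_distrib_mat_vec[of _ r "m + k"])
    qed
    have "fst F *\<^sub>v (fst (?P (L # Ls)) *\<^sub>v x) \<in> fst S" if "x \<in> carrier_vec (sdim1 (L # Ls))" for x
    proof -
      from that have "x \<in> carrier_vec (dim1 L + sdim1 Ls)" by simp
      then obtain a b
        where ab: "a \<in> carrier_vec (dim1 L)" "b \<in> carrier_vec (sdim1 Ls)" "x = a @\<^sub>v b"
        by (rule append_vec_cases)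
      have c: "(if L \<in> preinjectives then a else 0\<^sub>v (dim1 L)) \<in> carrier_vec (dim1 L)"
        "fst (?P Ls) *\<^sub>v b \<in> carrier_vec (sdim1 Ls)"
        using ab mult_mat_vec_carrier[OF subsum_proj_carrier(1)] by auto
      show ?thesis
        unfolding ab(3) subsum_proj_Cons_mult_vec(1)[OF ab(1,2)] split[OF cF(1) c]
        by (intro kron_submoduleD(3)[OF S] left1 right ab)
    qed
    moreover have "snd F *\<^sub>v (snd (?P (L # Ls)) *\<^sub>v x) \<in> snd S" if "x \<in> carrier_vec (sdim2 (L # Ls))" for x
    proof -
      from that have "x \<in> carrier_vec (dim2 L + sdim2 Ls)" by simp
      then obtain a b
        where ab: "a \<in> carrier_vec (dim2 L)" "b \<in> carrier_vec (sdim2 Ls)" "x = a @\<^sub>v b"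
        by (rule append_vec_cases)
      have c: "(if L \<in> preinjectives then a else 0\<^sub>v (dim2 L)) \<in> carrier_vec (dim2 L)"
        "snd (?P Ls) *\<^sub>v b \<in> carrier_vec (sdim2 Ls)"
        using ab mult_mat_vec_carrier[OF subsum_proj_carrier(2)] by auto
      show ?thesis
        unfolding ab(3) subsum_proj_Cons_mult_vec(2)[OF ab(1,2)] split[OF cF(2) c]
        by (intro kron_submoduleD(6)[OF S] left2 right' ab)
    qed
    ultimately show ?case by blast
  qed
  moreover have wf: "wf_reps Ls" using assms(4) by (rule indecomposables_wf)
  note D = kron_dsum_reps[OF wf]
  note P = subsum_proj_hom[OF wf, of preinjectives]
  note FP = kron_comp_hom[OF P assms(6) D D M] and FPv = kron_comp_mult_vec[OF P assms(6) D D M]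
  ultimately show ?thesis
    unfolding kron_part_def sub_le_image_iff[OF FP D M] by (simp add: FPv)
qed

section \<open>From a basis of the Hom space to all homomorphisms\<close>

text \<open>The homomorphisms with image in \<open>S\<close> form a subspace of those with image in
  \<open>N\<close>. It contains every \<open>g i\<close>, hence their span, which is the whole
  space. So \<open>S\<close> contains the image of every homomorphism into \<open>N\<close>.\<close>

lemma sub_sum_kron_images_of_basis:
  fixes M :: "'k::field kron_rep" and g :: "'i \<Rightarrow> 'k kron_map"
  assumes L: "L \<in> kron_reps e1 e2" and M: "M \<in> kron_reps d1 d2" and N: "kron_submodule M N"
    and I: "finite I" and basis: "vectorspace.basis class_ring (kron_hom_space L M N) (g ` I)"
  defines "S \<equiv> sub_sum M (\<lambda>i. kron_image (g i)) I"
  shows "kron_submodule M S"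
    and "\<And>i. i \<in> I \<Longrightarrow> g i \<in> kron_hom L M"
    and "\<And>W. kron_submodule M W \<Longrightarrow> (\<And>i. i \<in> I \<Longrightarrow> sub_le (kron_image (g i)) W) \<Longrightarrow> sub_le S W"
    and "\<And>h. h \<in> kron_hom L M \<Longrightarrow> sub_le (kron_image h) N \<Longrightarrow> sub_le (kron_image h) S"
proof -
  let ?V = "kron_hom_space L M N"
  interpret V: vectorspace class_ring ?V by (rule vectorspace_kron_hom_space[OF L M N])
  have carrier: "carrier ?V = kron_hom_into L M N" by (simp add: kron_hom_space_def)
  have g: "g ` I \<subseteq> kron_hom_into L M N" and span: "V.span (g ` I) = kron_hom_into L M N"
    using basis by (auto simp: V.basis_def carrier)
  \<comment> \<open>Facts about finite sums ask for a submodule at every index, so \<open>N\<close>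
    serves as default value outside \<open>I\<close>; the sum over \<open>I\<close> does not see
    it.\<close>
  define U where "U i = (if i \<in> I then kron_image (g i) else N)" for i
  have U: "kron_submodule M (U i)" for i
    using g N kron_submodule_image[OF L M, of "g i"] by (auto simp: U_def kron_hom_into_def)
  have S_U: "S = sub_sum M U I" unfolding S_def U_def sub_sum_def by simp
  note lub = sub_sum_lub[of M d1 d2 I U, OF M I U, folded S_U]
  show S: "kron_submodule M S" using lub by simp
  show "i \<in> I \<Longrightarrow> g i \<in> kron_hom L M" for i using g by (auto simp: kron_hom_into_def)
  show le: "sub_le S W" if "kron_submodule M W" "\<And>i. i \<in> I \<Longrightarrow> sub_le (kron_image (g i)) W" for W
    using that conjunct2[OF conjunct2[OF lub]] unfolding U_def by (metis (mono_tags))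
  have "sub_le S N"
    using g by (intro le N) (auto simp: kron_hom_into_def sub_le_def)
  then have sub: "kron_hom_into L M S \<subseteq> kron_hom_into L M N"
    by (auto simp: kron_hom_into_def sub_le_def)
  interpret W: vectorspace class_ring "kron_hom_space L M S" by (rule vectorspace_kron_hom_space[OF L M S])
  \<comment> \<open>The spaces for \<open>S\<close> and \<open>N\<close> share their operations and
    differ only in the carrier, so closure is read off from the vector space for
    \<open>S\<close>.\<close>
  have "submodule class_ring (kron_hom_into L M S) ?V"
    using sub V.module_axioms W.add.m_closed W.zero_closed W.smult_closed
    by (intro submodule.intro) (simp_all add: kron_hom_space_def)
  moreover have "g ` I \<subseteq> kron_hom_into L M S"
    using lub g by (auto simp: U_def kron_hom_into_def sub_le_def image_subset_iff)
  ultimately have *: "V.span (g ` I) \<subseteq> kron_hom_into L M S" by (rule V.span_is_subset[rotated])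
  show "sub_le (kron_image h) S" if "h \<in> kron_hom L M" "sub_le (kron_image h) N" for h
  proof -
    have "h \<in> kron_hom_into L M N" using that by (simp add: kron_hom_into_def sub_le_def)
    then have "h \<in> kron_hom_into L M S" using * unfolding span by blast
    then show ?thesis by (simp add: kron_hom_into_def sub_le_def)
  qed
qed

theorem proposition5p3:
  fixes M :: "'k::alg_closed_field kron_rep"
    and d1 d2 b :: nat
    and Ls :: "'k kron_rep list"
    and F :: "'k kron_map"
    and g :: "nat \<Rightarrow> 'k kron_map"
  assumes "M \<in> kron_reps d1 d2"
    and "kron_decomposition M Ls F"
    and "inj_on g {1..b}"
    and "vectorspace.basis class_ring
           (kron_hom_space (kron_I d1) M (sub_plus (regular_part Ls F) (preinjective_part Ls F)))
           (g ` {1..b})"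
  shows "sub_sum M (\<lambda>i. kron_image (g i)) {1..b} = preinjective_part Ls F"
proof -
  note M = assms(1)
  have Ls: "set Ls \<subseteq> indecomposables" and F: "F \<in> kron_hom (kron_dsum Ls) M"
    using assms(2) by (auto simp: kron_decomposition_def kron_iso_def)
  obtain G where G: "G \<in> kron_hom M (kron_dsum Ls)" and FG: "kron_comp F G = kron_id M"
    and GF: "kron_comp G F = kron_id (kron_dsum Ls)"
    using assms(2) by (auto simp: kron_decomposition_def kron_iso_def)
  have wf: "wf_reps Ls" by (rule indecomposables_wf[OF Ls])
  note D = kron_dsum_reps[OF wf]
  have part: "kron_submodule M (kron_part X Ls F)" for X
    unfolding kron_part_def
    by (rule kron_submodule_image[OF D M kron_comp_hom[OF subsum_proj_hom[OF wf] F D D M]])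
  let ?I = "kron_I d1 :: 'k kron_rep" and ?N = "sub_plus (regular_part Ls F) (preinjective_part Ls F)"
  let ?P = "subsum_proj preinjectives Ls" and ?S = "sub_sum M (\<lambda>i. kron_image (g i)) {1..b}"
  \<comment> \<open>The map \<open>G\<close> carries \<open>h\<close> into the direct sum, where the
    projection onto the preinjective summands fixes its values. Applying \<open>F\<close> gives back
    \<open>h\<close>, since \<open>F\<close> after \<open>G\<close> is the identity; so the values
    of \<open>h\<close> lie in the preinjective part.\<close>
  have into: "sub_le (kron_image h) (preinjective_part Ls F)" if h: "h \<in> kron_hom ?I M" for h
  proof -
    note P = subsum_proj_hom[OF wf, of preinjectives]
    note FPv = kron_comp_mult_vec[OF P F D D M]
    note Gh = kron_comp_hom[OF h G kron_I_reps M D]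
    note Ghv = kron_comp_mult_vec[OF h G kron_I_reps M D]
    note PGh = hom_kron_I_into_preinjectives[OF Ls Gh]
    note FP = kron_comp_hom[OF P F D D M]
    note FGv = kron_comp_mult_vec[OF G F M D M, unfolded FG kron_id_def fst_conv snd_conv kron_reps_dims[OF M]]
    note ch = kron_hom_carrier[OF h kron_I_reps M] and cG = kron_hom_carrier[OF G M D]
      and cFP = kron_hom_carrier[OF FP D M]
    have "fst h *\<^sub>v x \<in> fst (preinjective_part Ls F)" if x: "x \<in> carrier_vec d1" for x
      unfolding kron_part_def kron_image_def fst_conv
    proof
      have y: "fst G *\<^sub>v (fst h *\<^sub>v x) \<in> carrier_vec (sdim1 Ls)" using x ch cG by auto
      then show "fst G *\<^sub>v (fst h *\<^sub>v x) \<in> carrier_vec (dim_col (fst (kron_comp F ?P)))" using cFP by simp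
      show "fst h *\<^sub>v x = fst (kron_comp F ?P) *\<^sub>v (fst G *\<^sub>v (fst h *\<^sub>v x))"
        using x ch PGh(1)[OF x] FPv(1)[OF y] FGv(1)[of "fst h *\<^sub>v x"] by (simp add: Ghv)
    qed
    moreover have "snd h *\<^sub>v x \<in> snd (preinjective_part Ls F)" if x: "x \<in> carrier_vec (d1 - 1)" for x
      unfolding kron_part_def kron_image_def snd_conv
    proof
      have y: "snd G *\<^sub>v (snd h *\<^sub>v x) \<in> carrier_vec (sdim2 Ls)" using x ch cG by auto
      then show "snd G *\<^sub>v (snd h *\<^sub>v x) \<in> carrier_vec (dim_col (snd (kron_comp F ?P)))" using cFP by simp
      show "snd h *\<^sub>v x = snd (kron_comp F ?P) *\<^sub>v (snd G *\<^sub>v (snd h *\<^sub>v x))"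
        using x ch PGh(2)[OF x] FPv(2)[OF y] FGv(2)[of "snd h *\<^sub>v x"] by (simp add: Ghv)
    qed
    ultimately show ?thesis unfolding sub_le_image_iff[OF h kron_I_reps M] by blast
  qed
  have N: "kron_submodule M ?N" by (rule kron_submodule_sub_plus[OF M part part])
  note S = sub_sum_kron_images_of_basis[OF kron_I_reps M N finite_atLeastAtMost assms(4)]
  \<comment> \<open>By \<open>into\<close>, every homomorphism from \<open>?I\<close> to
    \<open>M\<close> already lands in \<open>?N\<close>, so it belongs to the space spanned by the
    given basis.\<close>
  have homs: "sub_le (kron_image h) ?S" if h: "h \<in> kron_hom ?I M" for h
    by (rule S(4)[OF h sub_le_trans[OF into[OF h] sub_le_plus_right[OF part part]]])
  have "m \<le> d1" if "kron_I m \<in> set Ls" for m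
  proof -
    have "m = dim1 (kron_I m :: 'k kron_rep)" by (rule kron_reps_dims(1)[OF kron_I_reps, symmetric])
    also have "\<dots> \<le> sdim1 Ls" using that by (intro member_le_sum_list) auto
    \<comment> \<open>At the first vertex, \<open>G\<close> after \<open>F\<close> is the identity
      on a space of dimension \<open>sdim1 Ls\<close> that factors through dimension
      \<open>d1\<close>.\<close>
    also have "\<dots> \<le> d1"
      using GF kron_hom_carrier(1)[OF G M D] kron_hom_carrier(1)[OF F D M]
      by (intro inverse_mats_dim_le[of "fst G" _ _ "fst F"])
        (auto simp: kron_comp_def kron_id_def kron_reps_dims(1)[OF D])
    finally show ?thesis .
  qed
  then have "sub_le (preinjective_part Ls F) ?S"
    by (intro preinjectives_covered[OF M S(1) homs Ls _ F])
  \<comment> \<open>Each \<open>g i\<close> is itself a homomorphism from \<open>?I\<close> to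
    \<open>M\<close>, so \<open>into\<close> bounds every term of the sum.\<close>
  moreover have "sub_le ?S (preinjective_part Ls F)"
    by (intro S(3) part into S(2))
  ultimately show ?thesis by (intro sub_le_antisym)
qed

end
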